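(* Let $R$ be a finite chain ring of length $2$ with residue field $\mathbb{F}_q$, and let $n$ be an integer with $q^2-q\le n\le q^2-2$. Then there exists a projective $(q^2n-2q,\,n)$-arc in $\mathrm{PHG}(2,R)$. Consequently, writing $n=q^2-q+t$ with $t\in\{0,1,\dots,q-2\}$, $$\mathrm{m}_n(R)\ge q(q+1)n-q^3+q(q-2-t).$$
   Context: Throughout, $R$ is a finite chain ring of nilpotency index (length) $2$, i.e. a finite local ring with radical $\mathrm{rad}R\neq 0$, $(\mathrm{rad}R)^2=0$, whose one-sided ideals form the chain $R\supsetneq\mathrm{rad}R\supsetneq 0$, with residue field $R/\mathrm{rad}R\cong\mathbb{F}_q$ ($q$ a prime power); then $|R|=q^2$. The projective Hjelmslev plane $\mathrm{PHG}(2,R)$ is the incidence structure whose points are the free rank-$1$ submodules of the right module $R_R^3$, whose lines are the free rank-$2$ submodules of $R_R^3$, with incidence given by inclusion; it has $q^4+q^3+q^2$ points and each line contains $q^2+q$ points. A $(k,n)$-arc is a map $\mathcal{K}$ from the point set to $\mathbb{N}_0$ with $\sum_x\mathcal{K}(x)=k$ and $\sum_{x\in L}\mathcal{K}(x)\le n$ for every line $L$; it is projective if $\mathcal{K}$ takes only values in $\{0,1\}$ (i.e. it is a set of $k$ points meeting every line in at most $n$ points). For $0\le n\le q^2+q$, $\mathrm{m}_n(R)$ denotes the largest $k$ such that a projective $(k,n)$-arc exists in $\mathrm{PHG}(2,R)$. *)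

theory Defs
  imports Main
begin

definition right_ideal :: "'a::ring_1 set \<Rightarrow> bool" where
  "right_ideal I \<longleftrightarrow> 0 \<in> I \<and> (\<forall>x\<in>I. \<forall>y\<in>I. x + y \<in> I) \<and> (\<forall>x\<in>I. - x \<in> I)
     \<and> (\<forall>x\<in>I. \<forall>r. x * r \<in> I)"

definition left_ideal :: "'a::ring_1 set \<Rightarrow> bool" where
  "left_ideal I \<longleftrightarrow> 0 \<in> I \<and> (\<forall>x\<in>I. \<forall>y\<in>I. x + y \<in> I) \<and> (\<forall>x\<in>I. - x \<in> I)
     \<and> (\<forall>x\<in>I. \<forall>r. r * x \<in> I)"

definition max_right_ideal :: "'a::ring_1 set \<Rightarrow> bool" where
  "max_right_ideal I \<longleftrightarrow> right_ideal I \<and> I \<noteq> UNIV \<and>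
     (\<forall>J. right_ideal J \<and> I \<subseteq> J \<and> J \<noteq> UNIV \<longrightarrow> J = I)"

definition rad :: "'a::ring_1 itself \<Rightarrow> 'a set" where
  "rad _ = \<Inter> {I. max_right_ideal I}"

definition chain_ring_len2 :: "'a::{ring_1,finite} itself \<Rightarrow> bool" where
  "chain_ring_len2 R \<longleftrightarrow> rad R \<noteq> {0}
     \<and> (\<forall>x\<in>rad R. \<forall>y\<in>rad R. x * y = 0)
     \<and> {I. right_ideal I} = {UNIV, rad R, {0}}
     \<and> {I. left_ideal I} = {UNIV, rad R, {0}}"

definition residue_card :: "'a::{ring_1,finite} itself \<Rightarrow> nat" where
  "residue_card R = card (UNIV :: 'a set) div card (rad R)"

type_synonym 'a vec3 = "'a \<times> 'a \<times> 'a"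

definition vadd :: "'a::ring_1 vec3 \<Rightarrow> 'a vec3 \<Rightarrow> 'a vec3" where
  "vadd u v = (fst u + fst v, fst (snd u) + fst (snd v), snd (snd u) + snd (snd v))"

definition smul_r :: "'a::ring_1 vec3 \<Rightarrow> 'a \<Rightarrow> 'a vec3" where
  "smul_r v r = (fst v * r, fst (snd v) * r, snd (snd v) * r)"

definition is_point :: "'a::ring_1 vec3 set \<Rightarrow> bool" where
  "is_point S \<longleftrightarrow> (\<exists>v. S = {smul_r v r | r. True} \<and> (\<forall>r. smul_r v r = (0,0,0) \<longrightarrow> r = 0))"

definition is_line :: "'a::ring_1 vec3 set \<Rightarrow> bool" where
  "is_line S \<longleftrightarrow> (\<exists>u v. S = {vadd (smul_r u r) (smul_r v s) | r s. True}
      \<and> (\<forall>r s. vadd (smul_r u r) (smul_r v s) = (0,0,0) \<longrightarrow> r = 0 \<and> s = 0))"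

definition proj_arc :: "nat \<Rightarrow> nat \<Rightarrow> 'a::{ring_1,finite} vec3 set set \<Rightarrow> bool" where
  "proj_arc k n P \<longleftrightarrow> (\<forall>x\<in>P. is_point x) \<and> card P = k
     \<and> (\<forall>L. is_line L \<longrightarrow> card {x\<in>P. x \<subseteq> L} \<le> n)"

definition m_n :: "'a::{ring_1,finite} itself \<Rightarrow> nat \<Rightarrow> nat" where
  "m_n R n = Max {k. \<exists>P :: 'a vec3 set set. proj_arc k n P}"

end

theory Submission
  imports Defs
begin

text \<open>
  Put \<open>N = rad R\<close> and \<open>s = q\<^sup>2 - n\<close>, so \<open>2 \<le> s \<le> q\<close>. Since a line has \<open>q\<^sup>2 + q\<close> points, it suffices to
  find a set of \<open>q\<^sup>3 + (s + 1) q\<^sup>2 + 2 q\<close> bad points that meets every line at least \<open>q + s\<close> times;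
  the arc is its complement. Modulo \<open>N\<close> the plane is a projective plane of order \<open>q\<close>, and
  every neighbour class of points is an affine plane of order \<open>q\<close> whose lines (segments) are cut out by the
  lines of the Hjelmslev plane. A segment meets a line of another direction through its class exactly
  once, and a line of its own direction in \<open>q\<close> points or not at all.

  Fix the class \<open>(0:0:1)\<close> and a subset \<open>U \<supseteq> {0, 1}\<close> of the residue field with \<open>s\<close> elements.
  On the class line \<open>x = a\<close> with \<open>a \<in> U - {0, 1}\<close> (a heavy \<open>a\<close>) every class \<open>(1:a:b)\<close> gets two segments in the
  direction of this class line, placed so that every line of the neighbour class is hit. For all other
  \<open>a\<close> the class \<open>(1:a:b)\<close> gets one segment directed to the class \<open>(0:1:a)\<close>, which compensates by having three
  instead of two segments. All segments at infinity point along the line at infinity and are chosen such that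
  every line in its neighbour class is hit at least twice; the class \<open>(0:0:1)\<close> has \<open>s\<close> of them.
  For \<open>q = 2\<close> there is no room for three segments in a class, but there four points in general
  position suffice.
\<close>

section \<open>Units, radical and residues in a chain ring of length 2\<close>

locale len2_chain_ring =
  fixes N T :: "'a::{ring_1,finite} set" and q :: nat and \<theta> :: 'a
  assumes N_right: "right_ideal N" and N_left: "left_ideal N"
    and N_sq: "\<And>x y. x \<in> N \<Longrightarrow> y \<in> N \<Longrightarrow> x * y = 0"
    and one_notin_N: "1 \<notin> N"
    and right_ideals: "\<And>I. right_ideal I \<Longrightarrow> I \<in> {UNIV, N, {0}}"
    and card_quot: "card (UNIV :: 'a set) div card N = q"
    and T_ex1: "\<And>r. \<exists>!t. t \<in> T \<and> r - t \<in> N"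
    and zero_T: "0 \<in> T" and one_T: "1 \<in> T"
    and theta_N: "\<theta> \<in> N" and theta_nz: "\<theta> \<noteq> 0"
begin

lemma zero_N [simp]: "0 \<in> N"
  and N_add: "x \<in> N \<Longrightarrow> y \<in> N \<Longrightarrow> x + y \<in> N"
  and N_neg: "x \<in> N \<Longrightarrow> - x \<in> N"
  and N_mult_right: "x \<in> N \<Longrightarrow> x * r \<in> N"
  using N_right by (auto simp: right_ideal_def)

lemma N_mult_left: "x \<in> N \<Longrightarrow> r * x \<in> N"
  using N_left by (auto simp: left_ideal_def)

lemma N_diff: "x \<in> N \<Longrightarrow> y \<in> N \<Longrightarrow> x - y \<in> N"
  using N_add[of x "- y"] N_neg[of y] by simp

lemma N_diff_iff: "y \<in> N \<Longrightarrow> x - y \<in> N \<longleftrightarrow> x \<in> N"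
  using N_add[of "x - y" y] N_diff[of x y] by auto

lemma right_ideal_principal: "right_ideal (range ((*) x))" for x :: 'a
  unfolding right_ideal_def
proof (intro conjI ballI allI)
  show "0 \<in> range ((*) x)" by (rule image_eqI[of _ _ 0]) auto
  show "a + b \<in> range ((*) x)" if "a \<in> range ((*) x)" "b \<in> range ((*) x)" for a b
    using that by (auto simp flip: distrib_left)
  show "- a \<in> range ((*) x)" if "a \<in> range ((*) x)" for a
    using that by (auto simp flip: mult_minus_right)
  show "a * r \<in> range ((*) x)" if "a \<in> range ((*) x)" for a r
    using that by (auto simp: mult.assoc)
qed

text \<open>The right ideal generated by \<open>x\<close> is not inside \<open>N\<close>, hence is
  everything. A right inverse of \<open>x\<close> is again outside the left ideal \<open>N\<close>,
  so it has a right inverse too, which must be \<open>x\<close>.\<close>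

lemma unit_ex:
  assumes "x \<notin> N"
  obtains y where "x * y = 1" "y * x = 1"
proof -
  have right_inv: "\<exists>y. z * y = 1" if "z \<notin> N" for z
  proof -
    have "z \<in> range ((*) z)" by (metis mult.right_neutral rangeI)
    then have "range ((*) z) = UNIV"
      using right_ideals[OF right_ideal_principal[of z]] that zero_N by (metis insert_iff empty_iff)
    then show ?thesis by (metis UNIV_I imageE)
  qed
  obtain y where y: "x * y = 1" using right_inv assms by blast
  then have "y \<notin> N" using N_mult_left one_notin_N by metis
  then obtain w where w: "y * w = 1" using right_inv by blast
  then have "w = x" by (metis y mult.assoc mult.left_neutral mult.right_neutral)
  then show ?thesis using that y w by blast
qed

lemma mult_right_eq_0: "x * r = 0 \<Longrightarrow> x \<noteq> 0 \<Longrightarrow> r \<in> N"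
  by (metis unit_ex mult.assoc mult.right_neutral mult_zero_left)

lemma N_eq_range: "x \<in> N \<Longrightarrow> x \<noteq> 0 \<Longrightarrow> N = range ((*) x)"
proof -
  assume x: "x \<in> N" "x \<noteq> 0"
  have "x \<in> range ((*) x)" by (metis mult.right_neutral rangeI)
  moreover have "range ((*) x) \<subseteq> N" using N_mult_right x by auto
  ultimately show ?thesis
    using right_ideals[OF right_ideal_principal[of x]] x one_notin_N by auto
qed

definition rep :: "'a \<Rightarrow> 'a" where
  "rep r = (THE t. t \<in> T \<and> r - t \<in> N)"

lemma rep_T: "rep r \<in> T" and rep_diff: "r - rep r \<in> N"
  using theI'[OF T_ex1[of r]] by (auto simp: rep_def)

lemma rep_eqI: "t \<in> T \<Longrightarrow> r - t \<in> N \<Longrightarrow> rep r = t"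
  using T_ex1[of r] rep_T[of r] rep_diff[of r] by blast

lemma rep_add: "t \<in> T \<Longrightarrow> n \<in> N \<Longrightarrow> rep (t + n) = t"
  by (rule rep_eqI) auto

lemma rep_ident: "t \<in> T \<Longrightarrow> rep t = t"
  by (rule rep_eqI) auto

lemma rep_cong: "x - y \<in> N \<Longrightarrow> rep x = rep y"
  using N_add[of "x - y" "y - rep y"] rep_diff[of y] by (intro rep_eqI rep_T) auto

lemma T_diff_N: "t \<in> T \<Longrightarrow> t' \<in> T \<Longrightarrow> t - t' \<in> N \<Longrightarrow> t = t'"
  using rep_eqI[of t' t] rep_ident[of t] by simp

lemma T_N: "t \<in> T \<Longrightarrow> t \<in> N \<longleftrightarrow> t = 0"
  using T_diff_N[of t 0] zero_T by auto

text \<open>As products within \<open>N\<close> vanish, \<open>N\<close> is a right vector space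
  over the residue field, which \<open>T\<close> represents.\<close>

lemma N_mult_rep: "x \<in> N \<Longrightarrow> x * rep r = x * r"
  using N_sq[OF _ rep_diff, of x r] by (simp add: right_diff_distrib)

lemma bij_T_N: "bij_betw (\<lambda>(t, n). t + n) (T \<times> N) UNIV"
proof (rule bij_betw_imageI)
  show "inj_on (\<lambda>(t, n). t + n) (T \<times> N)"
  proof (rule inj_onI, clarify)
    fix t n t' n' assume *: "t \<in> T" "n \<in> N" "t' \<in> T" "n' \<in> N" "t + n = t' + n'"
    then have "t = t'" using rep_add[of t n] rep_add[of t' n'] by simp
    then show "t = t' \<and> n = n'" using * by simp
  qed
  show "(\<lambda>(t, n). t + n) ` (T \<times> N) = UNIV"
  proof (intro equalityI subset_UNIV subsetI)
    fix r :: 'a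
    show "r \<in> (\<lambda>(t, n). t + n) ` (T \<times> N)"
      using rep_T[of r] rep_diff[of r] by (intro image_eqI[of _ _ "(rep r, r - rep r)"]) auto
  qed
qed

lemma card_N_pos: "card N > 0"
  using zero_N by (metis card_gt_0_iff empty_iff finite)

lemma card_T: "card T = q"
proof -
  have "card T * card N = card (UNIV :: 'a set)"
    using bij_betw_same_card[OF bij_T_N] by (simp add: card_cartesian_product)
  then show ?thesis using card_quot card_N_pos by (metis div_mult_self_is_m)
qed

text \<open>That space is one-dimensional: a nonzero \<open>x\<close> generates \<open>N\<close>,
  and \<open>T\<close> supplies the coordinates.\<close>

lemma bij_mult_T:
  assumes "x \<in> N" "x \<noteq> 0" shows "bij_betw ((*) x) T N"
proof (rule bij_betw_imageI)
  show "inj_on ((*) x) T"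
  proof (rule inj_onI)
    fix t t' assume *: "t \<in> T" "t' \<in> T" "x * t = x * t'"
    then have "x * (t - t') = 0" by (simp add: right_diff_distrib)
    then show "t = t'" using mult_right_eq_0 assms T_diff_N * by blast
  qed
  show "(*) x ` T = N"
  proof (intro equalityI subsetI)
    fix y assume "y \<in> N"
    then obtain r where "y = x * r" using N_eq_range[OF assms] by auto
    then show "y \<in> (*) x ` T" using N_mult_rep[OF assms(1), of r] rep_T[of r] by (metis imageI)
  qed (use N_mult_right assms in auto)
qed

lemma mult_T_surj:
  assumes "x \<in> N" "x \<noteq> 0" "y \<in> N"
  obtains t where "t \<in> T" "y = x * t"
  using bij_betw_imp_surj_on[OF bij_mult_T[OF assms(1,2)]] assms(3) by auto

lemma card_N: "card N = q"
  using bij_betw_same_card[OF bij_mult_T[OF theta_N theta_nz]] card_T by simp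

lemma card_R: "card (UNIV :: 'a set) = q\<^sup>2"
  using bij_betw_same_card[OF bij_T_N] card_N card_T
  by (simp add: card_cartesian_product power2_eq_square)

lemma card_Collect_split: "card {r. P r} = (\<Sum>t\<in>T. card {n \<in> N. P (t + n)})"
proof -
  let ?f = "\<lambda>(t, n). t + n"
  let ?S = "SIGMA t:T. {n \<in> N. P (t + n)}"
  have "inj_on ?f ?S"
    using bij_betw_imp_inj_on[OF bij_T_N] by (rule inj_on_subset) auto
  moreover have "?f ` ?S = {r. P r}"
  proof (intro equalityI subsetI)
    fix r assume "r \<in> {r. P r}"
    then show "r \<in> ?f ` ?S"
      using rep_T[of r] rep_diff[of r] by (intro image_eqI[of _ _ "(rep r, r - rep r)"]) auto
  qed auto
  ultimately have "card {r. P r} = card ?S" by (metis card_image)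
  also have "\<dots> = (\<Sum>t\<in>T. card {n \<in> N. P (t + n)})" by (rule card_SigmaI) auto
  finally show ?thesis .
qed

text \<open>The values \<open>x + u * n\<close> run once through the coset of \<open>x\<close>,
  which contains one element of \<open>T\<close>. This yields the single common point of a segment
  and a line of another direction.\<close>

lemma card_mem_T:
  assumes "u \<notin> N" shows "card {n \<in> N. x + u * n \<in> T} = 1"
proof -
  obtain w where w: "u * w = 1" "w * u = 1" using unit_ex[OF assms] .
  define n where "n = w * (rep x - x)"
  have "rep x - x \<in> N" using N_neg[OF rep_diff[of x]] by simp
  then have n: "n \<in> N" unfolding n_def by (rule N_mult_left)
  have un: "u * n = rep x - x" by (simp add: n_def w flip: mult.assoc)
  have "{n \<in> N. x + u * n \<in> T} = {n}"
  proof (intro equalityI subsetI)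
    fix m assume "m \<in> {n \<in> N. x + u * n \<in> T}"
    then have "m \<in> N" "rep (x + u * m) = x + u * m" using rep_ident by auto
    moreover have "rep (x + u * m) = rep x" using N_mult_left[OF \<open>m \<in> N\<close>] by (intro rep_cong) simp
    ultimately have "u * m = u * n" by (simp add: un algebra_simps)
    then have "w * u * m = w * u * n" by (simp only: mult.assoc)
    then show "m \<in> {n}" using w by simp
  qed (use n un rep_T in auto)
  then show ?thesis by simp
qed

lemma card_mem_T_affine:
  assumes "u \<notin> N" shows "card {y. u * y - x \<in> T} = q"
proof -
  obtain w where w: "u * w = 1" "w * u = 1" using unit_ex[OF assms] .
  have eq: "{y. u * y - x \<in> T} = (\<lambda>t. w * (t + x)) ` T"
  proof (intro equalityI subsetI)
    fix y assume "y \<in> {y. u * y - x \<in> T}"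
    moreover have "y = w * (u * y - x + x)" by (simp add: w flip: mult.assoc)
    ultimately show "y \<in> (\<lambda>t. w * (t + x)) ` T" by blast
  next
    fix y assume "y \<in> (\<lambda>t. w * (t + x)) ` T"
    then obtain t where t: "t \<in> T" "y = w * (t + x)" by blast
    have "u * y = t + x" by (simp only: t(2) w mult_1_left flip: mult.assoc)
    then show "y \<in> {y. u * y - x \<in> T}" using t(1) by simp
  qed
  have "inj_on (\<lambda>t. w * (t + x)) T"
  proof (rule inj_onI)
    fix t t' assume "w * (t + x) = w * (t' + x)"
    then have "u * w * (t + x) = u * w * (t' + x)" by (simp only: mult.assoc)
    then show "t = t'" using w by simp
  qed
  then show ?thesis by (simp add: eq card_image card_T)
qed

lemma card_rep_eq:
  assumes "c \<in> T" shows "card {y. rep y = c} = q"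
proof -
  have "{y. rep y = c} = (+) c ` N"
  proof (intro equalityI subsetI)
    fix y assume "y \<in> {y. rep y = c}"
    then show "y \<in> (+) c ` N" using rep_diff[of y] by (intro image_eqI[of _ _ "y - c"]) auto
  qed (use rep_add assms in auto)
  then show ?thesis by (simp add: card_image card_N)
qed

section \<open>Linear equations of lines\<close>

lemma pivot_form:
  assumes indep: "\<And>r s. u1 * r + v1 * s = 0 \<Longrightarrow> u2 * r + v2 * s = 0 \<Longrightarrow> u3 * r + v3 * s = 0 \<Longrightarrow> s = 0"
    and u1: "u1 \<notin> N"
  shows "\<exists>a b c. (b \<notin> N \<or> c \<notin> N) \<and> a * u1 + b * u2 + c * u3 = 0 \<and> a * v1 + b * v2 + c * v3 = 0"
proof -
  obtain w where w: "u1 * w = 1" "w * u1 = 1" using unit_ex[OF u1] .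
  define x2 x3 where "x2 = v2 - u2 * w * v1" and "x3 = v3 - u3 * w * v1"
  have red: "\<exists>a. a * u1 + b * u2 + c * u3 = 0 \<and> a * v1 + b * v2 + c * v3 = 0"
    if "b * x2 + c * x3 = 0" for b c
  proof (intro exI conjI)
    define a where "a = - (b * u2 + c * u3) * w"
    have "a * u1 = - (b * u2 + c * u3)" by (simp add: a_def mult.assoc w)
    then show "a * u1 + b * u2 + c * u3 = 0" by simp
    show "a * v1 + b * v2 + c * v3 = 0"
      using that by (simp add: a_def x2_def x3_def algebra_simps)
  qed
  \<comment> \<open>If the remainder \<open>(x2, x3)\<close> after elimination with the pivot
    \<open>u1\<close> had both entries in \<open>N\<close>, then \<open>\<theta>\<close> would
    annihilate it and yield a nontrivial relation.\<close>
  have "x2 \<notin> N \<or> x3 \<notin> N"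
  proof (rule ccontr)
    assume "\<not> ?thesis"
    then have z: "x2 * \<theta> = 0" "x3 * \<theta> = 0" using N_sq theta_N by auto
    have "\<theta> = 0"
    proof (rule indep)
      show "u1 * (- (w * v1 * \<theta>)) + v1 * \<theta> = 0" by (simp add: w flip: mult.assoc)
      show "u2 * (- (w * v1 * \<theta>)) + v2 * \<theta> = 0" "u3 * (- (w * v1 * \<theta>)) + v3 * \<theta> = 0"
        using z by (simp_all add: x2_def x3_def algebra_simps)
    qed
    then show False using theta_nz by simp
  qed
  then show ?thesis
  proof
    assume "x2 \<notin> N"
    then obtain z where "z * x2 = 1" using unit_ex by metis
    then have "(- (x3 * z)) * x2 + 1 * x3 = 0" by (simp add: mult.assoc)
    then show ?thesis using red one_notin_N by blast
  next
    assume "x3 \<notin> N"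
    then obtain z where "z * x3 = 1" using unit_ex by metis
    then have "1 * x2 + (- (x2 * z)) * x3 = 0" by (simp add: mult.assoc)
    then show ?thesis using red one_notin_N by blast
  qed
qed

lemma line_in_hyperplane:
  assumes "is_line L"
  obtains a b c where "a \<notin> N \<or> b \<notin> N \<or> c \<notin> N"
    "\<And>x y z. (x, y, z) \<in> L \<Longrightarrow> a * x + b * y + c * z = 0"
proof -
  obtain u v where uv: "L = {vadd (smul_r u r) (smul_r v s) | r s. True}"
    "\<forall>r s. vadd (smul_r u r) (smul_r v s) = (0,0,0) \<longrightarrow> r = 0 \<and> s = 0"
    using assms unfolding is_line_def by blast
  obtain u1 u2 u3 where u: "u = (u1, u2, u3)" by (rule prod_cases3)
  obtain v1 v2 v3 where v: "v = (v1, v2, v3)" by (rule prod_cases3)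
  have indep: "r = 0" "s = 0"
    if "u1 * r + v1 * s = 0" "u2 * r + v2 * s = 0" "u3 * r + v3 * s = 0" for r s
    using uv(2)[rule_format, of r s] that by (simp_all add: u v vadd_def smul_r_def)
  have "u1 \<notin> N \<or> u2 \<notin> N \<or> u3 \<notin> N"
    using indep(1)[of \<theta> 0] N_sq theta_N theta_nz by auto
  then have "\<exists>a b c. (a \<notin> N \<or> b \<notin> N \<or> c \<notin> N) \<and>
      a * u1 + b * u2 + c * u3 = 0 \<and> a * v1 + b * v2 + c * v3 = 0"
  proof (elim disjE)
    assume "u1 \<notin> N"
    then show ?thesis using pivot_form[of u1 v1 u2 v2 u3 v3] indep by blast
  next
    assume "u2 \<notin> N"
    then obtain b a c where "a \<notin> N \<or> c \<notin> N" "b * u2 + a * u1 + c * u3 = 0" "b * v2 + a * v1 + c * v3 = 0"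
      using pivot_form[of u2 v2 u1 v1 u3 v3] indep by blast
    then show ?thesis by (metis add.commute)
  next
    assume "u3 \<notin> N"
    then obtain c a b where "a \<notin> N \<or> b \<notin> N" "c * u3 + a * u1 + b * u2 = 0" "c * v3 + a * v1 + b * v2 = 0"
      using pivot_form[of u3 v3 u1 v1 u2 v2] indep by blast
    then show ?thesis by (metis add.commute add.left_commute)
  qed
  then obtain a b c where abc: "a \<notin> N \<or> b \<notin> N \<or> c \<notin> N"
      "a * u1 + b * u2 + c * u3 = 0" "a * v1 + b * v2 + c * v3 = 0" by blast
  have "a * x + b * y + c * z = 0" if xyz: "(x, y, z) \<in> L" for x y z
  proof -
    obtain r s where "x = u1 * r + v1 * s" "y = u2 * r + v2 * s" "z = u3 * r + v3 * s"
      using xyz by (auto simp: uv(1) u v vadd_def smul_r_def)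
    then have "a * x + b * y + c * z = (a * u1 + b * u2 + c * u3) * r + (a * v1 + b * v2 + c * v3) * s"
      by (simp add: algebra_simps)
    then show ?thesis by (simp add: abc)
  qed
  then show ?thesis using that abc(1) by blast
qed

text \<open>The equation is solved for the last coordinate with a unit coefficient. Modulo
  \<open>N\<close> the cases are the lines off \<open>(0:0:1)\<close>, the lines through it other
  than the line at infinity, and the line at infinity.\<close>

lemma line_cases:
  assumes "is_line L"
  obtains (z) a b where "\<And>x y z. (x, y, z) \<in> L \<Longrightarrow> z = a * x + b * y"
  | (y) a c where "c \<in> N" "\<And>x y z. (x, y, z) \<in> L \<Longrightarrow> y = a * x + c * z"
  | (x) b c where "b \<in> N" "c \<in> N" "\<And>x y z. (x, y, z) \<in> L \<Longrightarrow> x = b * y + c * z"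
proof -
  obtain a b c where abc: "a \<notin> N \<or> b \<notin> N \<or> c \<notin> N"
    and L: "\<And>x y z. (x, y, z) \<in> L \<Longrightarrow> a * x + b * y + c * z = 0"
    using line_in_hyperplane[OF assms] by blast
  consider "c \<notin> N" | "c \<in> N" "b \<notin> N" | "c \<in> N" "b \<in> N" "a \<notin> N" using abc by blast
  then show ?thesis
  proof cases
    case 1
    then obtain w where w: "w * c = 1" using unit_ex by metis
    show ?thesis
    proof (rule z[of "- (w * a)" "- (w * b)"])
      fix x y z assume "(x, y, z) \<in> L"
      then have "w * (a * x + b * y + c * z) = 0" by (simp add: L)
      then have "w * a * x + w * b * y + z = 0" by (simp add: distrib_left w flip: mult.assoc)
      then show "z = - (w * a) * x + - (w * b) * y" by (simp add: algebra_simps eq_neg_iff_add_eq_0)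
    qed
  next
    case 2
    then obtain w where w: "w * b = 1" using unit_ex by metis
    show ?thesis
    proof (rule y[of "- (w * c)" "- (w * a)"])
      fix x y z assume "(x, y, z) \<in> L"
      then have "w * (a * x + b * y + c * z) = 0" by (simp add: L)
      then have "w * a * x + y + w * c * z = 0" by (simp add: distrib_left w flip: mult.assoc)
      then show "y = - (w * a) * x + - (w * c) * z" by (simp add: algebra_simps eq_neg_iff_add_eq_0)
    qed (use 2 N_neg N_mult_left in auto)
  next
    case 3
    then obtain w where w: "w * a = 1" using unit_ex by metis
    show ?thesis
    proof (rule x[of "- (w * b)" "- (w * c)"])
      fix x y z assume "(x, y, z) \<in> L"
      then have "w * (a * x + b * y + c * z) = 0" by (simp add: L)
      then have "x + w * b * y + w * c * z = 0" by (simp add: distrib_left w flip: mult.assoc)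
      then show "x = - (w * b) * y + - (w * c) * z" by (simp add: algebra_simps eq_neg_iff_add_eq_0)
    qed (use 3 N_neg N_mult_left in auto)
  qed
qed

section \<open>Points in normalised coordinates\<close>

definition point :: "'a vec3 \<Rightarrow> 'a vec3 set" where
  "point v = {smul_r v r | r. True}"

text \<open>The first unit coordinate is scaled to 1. The last two sets form the neighbour class of
  the line at infinity, the last one that of the point \<open>(0:0:1)\<close>.\<close>

definition normalised :: "'a vec3 set" where
  "normalised = {(1, x, y) | x y. True} \<union> {(n, 1, y) | n y. n \<in> N}
     \<union> {(n, m, 1) | n m. n \<in> N \<and> m \<in> N}"

lemma self_in_point: "v \<in> point v"
  by (cases v) (auto simp: point_def smul_r_def intro!: exI[of _ 1])

lemma is_point_point: "v \<in> normalised \<Longrightarrow> is_point (point v)"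
  unfolding is_point_def point_def
  by (rule exI[of _ v]) (auto simp: normalised_def smul_r_def)

lemma inj_on_point: "inj_on point normalised"
proof (rule inj_onI)
  fix v w assume vw: "v \<in> normalised" "w \<in> normalised" and "point v = point w"
  then have "v \<in> point w" using self_in_point[of v] by simp
  then obtain r where r: "v = smul_r w r" by (auto simp: point_def)
  have nr: "n * r \<in> N" "n * r \<noteq> 1" if "n \<in> N" for n
    using N_mult_right[OF that, of r] one_notin_N by auto
  have rn: "x * r \<noteq> 1" if "r \<in> N" for x
    using N_mult_left[OF that, of x] one_notin_N by auto
  have "r = 1"
    using vw nr rn one_notin_N unfolding normalised_def r smul_r_def by auto
  then show "v = w" by (simp add: r smul_r_def)
qed

text \<open>Surplus vectors are discarded, so a lower bound for \<open>card V\<close> is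
  enough.\<close>

lemma proj_arc_of_vectors:
  assumes "V \<subseteq> normalised" "k \<le> card V"
    and "\<And>L. is_line L \<Longrightarrow> card {v \<in> V. v \<in> L} \<le> n"
  shows "\<exists>P :: 'a vec3 set set. proj_arc k n P"
proof -
  obtain W where W: "W \<subseteq> V" "card W = k" by (meson assms(2) obtain_subset_with_card_n)
  have "card {x \<in> point ` W. x \<subseteq> L} \<le> n" if "is_line L" for L
  proof -
    have "{x \<in> point ` W. x \<subseteq> L} \<subseteq> point ` {v \<in> V. v \<in> L}"
      using self_in_point W by blast
    then have "card {x \<in> point ` W. x \<subseteq> L} \<le> card (point ` {v \<in> V. v \<in> L})"
      by (intro card_mono) auto
    also have "\<dots> \<le> card {v \<in> V. v \<in> L}" by (rule card_image_le) simp
    also have "\<dots> \<le> n" by (rule assms(3)[OF that])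
    finally show ?thesis .
  qed
  moreover have "card (point ` W) = k"
    using card_image[OF inj_on_subset[OF inj_on_point]] W assms(1) by blast
  moreover have "\<forall>x\<in>point ` W. is_point x" using W assms(1) is_point_point by blast
  ultimately show ?thesis unfolding proj_arc_def by blast
qed

lemma frame_arc: "\<exists>P :: 'a vec3 set set. proj_arc 4 2 P"
proof (rule proj_arc_of_vectors)
  let ?V = "{(1,0,0), (0,1,0), (0,0,1), (1,1,1)} :: 'a vec3 set"
  show "?V \<subseteq> normalised" by (auto simp: normalised_def)
  show "4 \<le> card ?V" by simp
  fix L :: "'a vec3 set" assume "is_line L"
  then obtain a b c where abc: "a \<notin> N \<or> b \<notin> N \<or> c \<notin> N"
    and L: "\<And>x y z. (x, y, z) \<in> L \<Longrightarrow> a * x + b * y + c * z = 0"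
    using line_in_hyperplane by blast
  have "\<exists>v w. {v \<in> ?V. v \<in> L} \<subseteq> {v, w}"
  proof (rule ccontr)
    assume *: "\<not> ?thesis"
    \<comment> \<open>At least three of the four vectors lie on \<open>L\<close>, hence one of each
      pair.\<close>
    have "(1,0,0) \<in> L \<or> (0,1,0) \<in> L" "(1,0,0) \<in> L \<or> (0,0,1) \<in> L" "(1,0,0) \<in> L \<or> (1,1,1) \<in> L"
      "(0,1,0) \<in> L \<or> (0,0,1) \<in> L" "(0,1,0) \<in> L \<or> (1,1,1) \<in> L" "(0,0,1) \<in> L \<or> (1,1,1) \<in> L"
      using * by blast+
    moreover have "(1,0,0) \<in> L \<Longrightarrow> a = 0" "(0,1,0) \<in> L \<Longrightarrow> b = 0" "(0,0,1) \<in> L \<Longrightarrow> c = 0"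
      "(1,1,1) \<in> L \<Longrightarrow> a + b + c = 0"
      using L[of 1 0 0] L[of 0 1 0] L[of 0 0 1] L[of 1 1 1] by auto
    ultimately have "a = 0 \<and> b = 0 \<and> c = 0" by auto
    then show False using abc by simp
  qed
  then obtain v w where "{v \<in> ?V. v \<in> L} \<subseteq> {v, w}" by blast
  then have "card {v \<in> ?V. v \<in> L} \<le> card {v, w}" by (intro card_mono) auto
  also have "\<dots> \<le> 2" by (simp add: card_insert_if)
  finally show "card {v \<in> ?V. v \<in> L} \<le> 2" .
qed

text \<open>In the applications \<open>f\<close> and \<open>g\<close> parametrise the
  \<open>q\<^sup>2 + q\<close> points of a line, and \<open>P\<close> and \<open>Q\<close> mark the
  bad ones.\<close>

lemma card_line_good:
  fixes P Q :: "'a \<Rightarrow> bool"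
  assumes "A \<subseteq> f ` {r. \<not> P r} \<union> g ` {n \<in> N. \<not> Q n}"
    and "q + s \<le> card {r. P r} + card {n \<in> N. Q n}"
  shows "card A + s \<le> q\<^sup>2"
proof -
  have "card ({r. \<not> P r} \<union> {r. P r}) = card {r. \<not> P r} + card {r. P r}"
    by (rule card_Un_disjoint) auto
  moreover have "{r. \<not> P r} \<union> {r. P r} = UNIV" by auto
  ultimately have P: "card {r. \<not> P r} + card {r. P r} = q\<^sup>2" using card_R by simp
  have "{n \<in> N. \<not> Q n} = N - {n \<in> N. Q n}" by auto
  then have Q: "card {n \<in> N. \<not> Q n} + card {n \<in> N. Q n} = q"
    using card_N card_mono[of N "{n \<in> N. Q n}"] by (simp add: card_Diff_subset)
  have "card A \<le> card (f ` {r. \<not> P r} \<union> g ` {n \<in> N. \<not> Q n})"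
    using assms(1) by (intro card_mono) auto
  also have "\<dots> \<le> card (f ` {r. \<not> P r}) + card (g ` {n \<in> N. \<not> Q n})" by (rule card_Un_le)
  also have "\<dots> \<le> card {r. \<not> P r} + card {n \<in> N. \<not> Q n}"
    by (intro add_mono card_image_le) auto
  finally show ?thesis using P Q assms(2) by linarith
qed

end

section \<open>Construction of the arc from bad segments\<close>

locale arc_construction = len2_chain_ring +
  fixes U :: "'a set" and e :: 'a
  assumes U_T: "U \<subseteq> T" and zero_U: "0 \<in> U" and one_U: "1 \<in> U"
    and e_N: "e \<in> N" and e_nz: "e \<noteq> 0" and e_theta: "e \<noteq> \<theta>"
begin

definition heavy :: "'a set" where
  "heavy = U - {0, 1}"

text \<open>
  The only property of \<open>\<phi>\<close> that matters is that it maps \<open>T\<close> onto the nonzero elements of \<open>N\<close>: in the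
  neighbour class of a heavy class line the segments at offset 0 hit all lines \<open>x = \<kappa> + \<gamma> y\<close> with \<open>\<gamma> \<noteq> 0\<close>, and those
  at offset \<open>\<phi> b\<close> hit the lines \<open>x = \<kappa>\<close>.
\<close>
definition \<phi> :: "'a \<Rightarrow> 'a" where
  "\<phi> t = (if t = 0 then \<theta> else \<theta> * t)"

text \<open>
  A line \<open>x = \<beta> y + \<gamma> z\<close> of the neighbour class of infinity contains the segment of offset \<open>n\<close> in the class
  \<open>(0:1:c)\<close> iff \<open>\<beta> + \<gamma> c = n\<close>, and the one in \<open>(0:0:1)\<close> iff \<open>\<gamma> = n\<close>. Dually, the offsets 0 and \<open>\<theta> c\<close>, together with
  \<open>\<gamma> = 0\<close> and \<open>\<gamma> = \<theta>\<close>, form the pencils of lines through the points \<open>(0, 0)\<close> and \<open>(0, \<theta>)\<close> of the \<open>(\<beta>, \<gamma>)\<close>-plane, which cover all points twice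
  except those with \<open>\<beta> = 0\<close>; the latter are covered again by \<open>\<gamma> \<in> \<theta> U\<close> or by the third offset at \<open>c\<close>, where
  \<open>\<gamma> = \<theta> c\<close>.
\<close>
definition D :: "'a \<Rightarrow> 'a set" where
  "D c = (if c \<in> {0, 1} then {0, \<theta>, e} else if c \<in> U then {0, \<theta> * c} else {0, \<theta> * c, \<theta> * c * c})"

text \<open>
  As \<open>T\<close> is a transversal of \<open>N\<close>, the condition \<open>y - a x \<in> T\<close> selects one segment of slope \<open>a\<close> in every class
  \<open>(1:a:b)\<close>.
\<close>
definition bad1 :: "'a \<Rightarrow> 'a \<Rightarrow> bool" where
  "bad1 x y \<longleftrightarrow> (if rep x \<in> heavy then x - rep x \<in> {0, \<phi> (rep y)} else y - rep x * x \<in> T)"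

definition bad2 :: "'a \<Rightarrow> 'a \<Rightarrow> bool" where
  "bad2 n y \<longleftrightarrow> n \<in> D (rep y)"

definition bad3 :: "'a \<Rightarrow> bool" where
  "bad3 n \<longleftrightarrow> n \<in> (*) \<theta> ` U"

definition arc :: "'a vec3 set" where
  "arc = {(1, x, y) | x y. \<not> bad1 x y} \<union> {(n, 1, y) | n y. n \<in> N \<and> \<not> bad2 n y}
     \<union> {(n, m, 1) | n m. n \<in> N \<and> m \<in> N \<and> \<not> bad3 n}"

lemma arc_normalised: "arc \<subseteq> normalised"
  by (auto simp: arc_def normalised_def)

lemma heavy_T: "heavy \<subseteq> T"
  using U_T by (auto simp: heavy_def)

lemma card_U: "card U = card heavy + 2"
proof -
  have "U = insert 0 (insert 1 heavy)" using zero_U one_U by (auto simp: heavy_def)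
  moreover have "card (insert 0 (insert 1 heavy)) = card heavy + 2" by (simp add: heavy_def)
  ultimately show ?thesis by simp
qed

lemma card_U_le: "card U \<le> q"
  using card_mono[OF _ U_T] card_T by simp

lemma sum_T_heavy: "(\<Sum>t\<in>T. if t \<in> heavy then A else B) = A * card heavy + B * (q - card heavy)"
  for A B :: nat
proof -
  have "(\<Sum>t\<in>T. if t \<in> heavy then A else B) = (\<Sum>t\<in>heavy. A) + (\<Sum>t\<in>T - heavy. B)"
    using heavy_T by (simp add: sum.If_cases Int_absorb1 Diff_eq)
  then show ?thesis using heavy_T card_T by (simp add: card_Diff_subset mult.commute)
qed

lemma theta_mult_eq_0: "\<theta> * r = 0 \<longleftrightarrow> r \<in> N"
  using mult_right_eq_0[of \<theta> r] theta_nz N_sq theta_N by auto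

lemma phi_range: "\<phi> ` T = N - {0}"
proof (intro equalityI subsetI)
  fix x assume "x \<in> N - {0}"
  then obtain t where "t \<in> T" "x = \<theta> * t" using mult_T_surj[OF theta_N theta_nz, of x] by blast
  then show "x \<in> \<phi> ` T" using \<open>x \<in> N - {0}\<close> by (intro image_eqI[of _ _ t]) (auto simp: \<phi>_def)
qed (use theta_N theta_nz theta_mult_eq_0 T_N N_mult_right in \<open>auto simp: \<phi>_def\<close>)

lemma D_N: "D c \<subseteq> N"
  using theta_N e_N N_mult_right by (auto simp: D_def)

text \<open>For \<open>c\<close> outside \<open>{0, 1}\<close> both \<open>c\<close> and
  \<open>1 - c\<close> are units, which separates the offsets. At 0 and 1 the offsets
  \<open>\<theta> * c\<close> and \<open>\<theta> * c * c\<close> coincide, so \<open>e\<close>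
  serves as the third one.\<close>

lemma card_D:
  assumes "c \<in> T" shows "card (D c) = (if c \<in> heavy then 2 else 3)"
proof (cases "c \<in> {0, 1}")
  case True
  then show ?thesis using theta_nz e_nz e_theta by (auto simp: D_def heavy_def)
next
  case False
  then have c: "c \<notin> N" "1 - c \<notin> N"
    using T_N[OF assms] T_diff_N[OF one_T assms] by auto
  have 1: "\<theta> * c \<noteq> 0" using theta_mult_eq_0 c by blast
  then have 2: "\<theta> * c * c \<noteq> 0" using mult_right_eq_0 c by blast
  have "\<theta> * c * (1 - c) \<noteq> 0" using mult_right_eq_0 1 c by blast
  then have "\<theta> * c \<noteq> \<theta> * c * c" by (simp add: right_diff_distrib)
  then show ?thesis using False 1 2 by (auto simp: D_def heavy_def)
qed

lemma zero_D: "0 \<in> D c" and theta_D: "\<theta> * c \<in> D c"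
  by (auto simp: D_def)

lemma D_third: "c \<notin> U \<Longrightarrow> \<theta> * c * c \<in> D c"
  using zero_U one_U by (auto simp: D_def)

section \<open>Bad points on the three kinds of lines\<close>

lemma card_bad3: "card {n \<in> N. bad3 n} = card U"
proof -
  have "{n \<in> N. bad3 n} = (*) \<theta> ` U" using theta_N N_mult_right by (auto simp: bad3_def)
  moreover have "inj_on ((*) \<theta>) U"
    using bij_betw_imp_inj_on[OF bij_mult_T[OF theta_N theta_nz]] U_T by (rule inj_on_subset)
  ultimately show ?thesis by (simp add: card_image)
qed

text \<open>A heavy residue contributes two bad points and any other residue one, except that the
  segment at a non-heavy \<open>c\<close>, the direction of the line, may be missed. The class at
  infinity makes up for this, as \<open>D c\<close> then has three elements instead of two.\<close>

lemma bad_on_z_line: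
  "q + card U \<le> card {x. bad1 x (a + b * x)} + card {n \<in> N. bad2 n (a * n + b)}"
proof -
  define c where "c = rep b"
  have c: "c \<in> T" "b - c \<in> N" using rep_T rep_diff by (auto simp: c_def)
  have local: "(if t \<in> heavy then 2 else 1) \<le>
      card {n \<in> N. bad1 (t + n) (a + b * (t + n))} + (if t = c \<and> c \<notin> heavy then 1 else 0)"
    if t: "t \<in> T" for t
  proof (cases "t \<in> heavy")
    case True
    define f where "f = \<phi> (rep (a + b * t))"
    have "f \<in> N - {0}" using phi_range rep_T unfolding f_def by blast
    have rep_y: "rep (a + b * (t + n)) = rep (a + b * t)" if "n \<in> N" for n
      using N_mult_left[OF that] by (intro rep_cong) (simp add: distrib_left)
    have "{n \<in> N. bad1 (t + n) (a + b * (t + n))} = {0, f}"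
      using True \<open>f \<in> N - {0}\<close> by (auto simp: bad1_def rep_add rep_ident t rep_y f_def)
    then show ?thesis using True \<open>f \<in> N - {0}\<close> by auto
  next
    case False
    \<comment> \<open>In \<open>n\<close> the segment condition is affine with slope
      \<open>b - t\<close>, a unit unless line and segment have the same direction.\<close>
    have "a + b * (t + n) - t * (t + n) = (a + (b - t) * t) + (b - t) * n" for n
      by (simp add: algebra_simps)
    then have eq: "{n \<in> N. bad1 (t + n) (a + b * (t + n))} =
        {n \<in> N. (a + (b - t) * t) + (b - t) * n \<in> T}"
      using False by (simp only: bad1_def rep_add t if_False cong: conj_cong)
    have "b - t \<notin> N" if "t \<noteq> c"
      using rep_eqI[OF t, of b] that by (auto simp: c_def)
    then show ?thesis
      using False card_mem_T[of "b - t" "a + (b - t) * t"] unfolding eq by (cases "t = c") auto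
  qed
  have "rep (a * n + b) = c" if "n \<in> N" for n
    unfolding c_def using N_mult_left[OF that] by (intro rep_cong) simp
  then have "{n \<in> N. bad2 n (a * n + b)} = D c" using D_N by (auto simp: bad2_def)
  then have "card {n \<in> N. bad2 n (a * n + b)} = (if c \<in> heavy then 2 else 3)"
    using card_D c by simp
  moreover have "q + card heavy \<le> (\<Sum>t\<in>T. if t \<in> heavy then 2 else 1)"
    using sum_T_heavy[of 2 1] card_U card_U_le by simp
  moreover have "(\<Sum>t\<in>T. if t \<in> heavy then 2 else 1) \<le>
      (\<Sum>t\<in>T. card {n \<in> N. bad1 (t + n) (a + b * (t + n))} + (if t = c \<and> c \<notin> heavy then 1 else 0))"
    by (intro sum_mono local)
  moreover have "(\<Sum>t\<in>T. if t = c \<and> c \<notin> heavy then 1 else 0) = (if c \<in> heavy then 0 else 1 :: nat)"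
    using c by (cases "c \<in> heavy") (auto simp: sum.delta)
  ultimately show ?thesis
    using card_U by (subst card_Collect_split) (auto simp: sum.distrib split: if_splits)
qed

text \<open>The class \<open>(0:0:1)\<close> gives \<open>card U\<close> bad points, so
  \<open>q\<close> affine ones are required. For heavy \<open>t\<close> the segments are parallel to
  the line, so it suffices that one of them lies on it, which gives \<open>q\<close> points at
  once.\<close>

lemma bad_on_y_line:
  assumes "c \<in> N"
  shows "q + card U \<le> card {y. bad1 (a + c * y) y} + card {n \<in> N. bad3 n}"
proof -
  define t where "t = rep a"
  have t: "t \<in> T" "a - t \<in> N" using rep_T rep_diff by (auto simp: t_def)
  have rep_x: "rep (a + c * y) = t" for y
    unfolding t_def using N_mult_right[OF assms] by (intro rep_cong) simp
  have "q \<le> card {y. bad1 (a + c * y) y}"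
  proof (cases "t \<in> heavy")
    case False
    have "1 - t * c \<notin> N" using N_diff_iff[of "t * c" 1] N_mult_left assms one_notin_N by blast
    then have "card {y. (1 - t * c) * y - t * a \<in> T} = q" by (rule card_mem_T_affine)
    moreover have "{y. bad1 (a + c * y) y} = {y. (1 - t * c) * y - t * a \<in> T}"
      using False by (auto simp: bad1_def rep_x algebra_simps)
    ultimately show ?thesis by simp
  next
    case True
    \<comment> \<open>\<open>a - t + c * d\<close> is the offset of the line in the class of
      \<open>d\<close>. If \<open>c \<noteq> 0\<close>, it vanishes for some \<open>d\<close>; if
      \<open>c = 0\<close>, it is constant and either 0 or a value of \<open>\<phi>\<close>.\<close>
    have "\<exists>d\<in>T. a - t + c * d \<in> {0, \<phi> d}"
    proof (cases "c = 0")
      case True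
      then show ?thesis using t phi_range zero_T by (cases "a - t = 0") (auto simp: set_eq_iff image_iff)
    next
      case False
      obtain d where "d \<in> T" "- (a - t) = c * d"
        using mult_T_surj[OF assms False N_neg[OF t(2)]] by blast
      then have "d \<in> T" "a - t + c * d = 0" by (metis add.right_inverse)+
      then show ?thesis by blast
    qed
    then obtain d where d: "d \<in> T" "a - t + c * d \<in> {0, \<phi> d}" by blast
    have "bad1 (a + c * y) y" if "rep y = d" for y
      using N_mult_rep[OF assms, of y] True d that by (auto simp: bad1_def rep_x algebra_simps)
    then have "card {y. rep y = d} \<le> card {y. bad1 (a + c * y) y}" by (intro card_mono) auto
    then show ?thesis using card_rep_eq[OF d(1)] by simp
  qed
  then show ?thesis by (simp add: card_bad3)
qed

lemma double_cover:
  assumes "b \<in> N" "c \<in> N"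
  shows "2 \<le> card {t \<in> T. b + c * t \<in> D t} + (if bad3 c then 1 else 0)"
proof -
  let ?H = "{t \<in> T. b + c * t \<in> D t}"
  have two: "2 \<le> card ?H" if "t \<in> ?H" "t' \<in> ?H" "t \<noteq> t'" for t t'
    using card_mono[of ?H "{t, t'}"] that by simp
  have one: "1 \<le> card ?H" if "t \<in> ?H" for t
    using card_mono[of ?H "{t}"] that by simp
  have bad3: "bad3 (\<theta> * u)" if "u \<in> U" for u using that by (simp add: bad3_def)
  have neg_b: "- b \<in> N" using N_neg assms by blast
  \<comment> \<open>\<open>c = 0\<close> and \<open>c = \<theta>\<close> are the pencil members that
    \<open>(0:0:1)\<close> supplies. Any other \<open>(b, c)\<close> gets a class \<open>t\<close>
    from the pencil through \<open>(0, 0)\<close> and a class \<open>t'\<close> from the one through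
    \<open>(0, \<theta>)\<close>.\<close>
  consider "c = 0" "b = 0" | "c = 0" "b \<noteq> 0" | "c = \<theta>" | "c \<noteq> 0" "c \<noteq> \<theta>" by blast
  then show ?thesis
  proof cases
    case 1
    then show ?thesis using two[of 0 1] zero_T one_T zero_D by simp
  next
    case 2
    obtain t where "t \<in> T" "b = \<theta> * t" using mult_T_surj[OF theta_N theta_nz assms(1)] .
    then have "t \<in> ?H" using 2 theta_D by simp
    then show ?thesis using one bad3[OF zero_U] 2 by fastforce
  next
    case 3
    obtain t where "t \<in> T" "- b = \<theta> * t" using mult_T_surj[OF theta_N theta_nz neg_b] .
    then have "t \<in> ?H" using 3 zero_D by (metis (mono_tags, lifting) add.right_inverse mem_Collect_eq)
    then show ?thesis using one bad3[OF one_U] 3 by fastforce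
  next
    case 4
    obtain t where t: "t \<in> T" "- b = c * t" using mult_T_surj[OF assms(2) 4(1) neg_b] .
    have bt: "b + c * t = 0" by (simp flip: t(2))
    then have tH: "t \<in> ?H" using t zero_D by simp
    have "\<theta> - c \<in> N" "\<theta> - c \<noteq> 0" using 4 N_diff theta_N assms by auto
    then obtain t' where t': "t' \<in> T" "b = (\<theta> - c) * t'" using mult_T_surj assms(1) by blast
    then have bt': "b + c * t' = \<theta> * t'" by (simp add: algebra_simps)
    then have t'H: "t' \<in> ?H" using t' theta_D by simp
    show ?thesis
    proof (cases "t = t'")
      case False
      then show ?thesis using two[OF tH t'H] by simp
    next
      case True
      \<comment> \<open>Both pencils give the same class only if \<open>(b, c)\<close> is on the
        line joining their centres, that is, \<open>b = 0\<close>.\<close>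
      then have "\<theta> * t = 0" using bt bt' by simp
      then have "t = 0" using theta_mult_eq_0 T_N t by blast
      then have b0: "b = 0" using bt by simp
      obtain u where u: "u \<in> T" "c = \<theta> * u" using mult_T_surj[OF theta_N theta_nz assms(2)] .
      show ?thesis
      proof (cases "u \<in> U")
        case True
        then show ?thesis using one[OF tH] bad3[OF True] u by simp
      next
        case False
        then have "u \<in> ?H" using D_third u b0 by simp
        moreover have "u \<noteq> 0" using False zero_U by blast
        ultimately show ?thesis using two[OF tH, of u] \<open>t = 0\<close> by simp
      qed
    qed
  qed
qed

text \<open>Such a line meets each class at infinity in a full segment, so every hit contributes
  \<open>q\<close> bad points; two hits suffice because \<open>card U \<le> q\<close>.\<close>

lemma bad_on_x_line:
  assumes "b \<in> N" "c \<in> N"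
  shows "q + card U \<le> card {y. bad2 (b + c * y) y} + card {m \<in> N. bad3 c}"
proof -
  let ?H = "{t \<in> T. b + c * t \<in> D t}"
  have "card {y. bad2 (b + c * y) y} = (\<Sum>t\<in>T. if b + c * t \<in> D t then q else 0)"
  proof (subst card_Collect_split, rule sum.cong)
    fix t assume t: "t \<in> T"
    have "c * (t + n) = c * t" if "n \<in> N" for n using N_sq assms that by (simp add: distrib_left)
    then have "{n \<in> N. bad2 (b + c * (t + n)) (t + n)} = (if b + c * t \<in> D t then N else {})"
      by (auto simp: bad2_def rep_add t)
    then show "card {n \<in> N. bad2 (b + c * (t + n)) (t + n)} = (if b + c * t \<in> D t then q else 0)"
      by (simp add: card_N)
  qed simp
  also have "\<dots> = card ?H * q"
    by (simp add: sum.If_cases Int_def)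
  finally have "card {y. bad2 (b + c * y) y} + card {m \<in> N. bad3 c} = (card ?H + (if bad3 c then 1 else 0)) * q"
    using card_N by (simp add: distrib_right)
  moreover have "2 * q \<le> \<dots>" using double_cover[OF assms] by (intro mult_right_mono) auto
  ultimately show ?thesis using card_U_le by linarith
qed

lemma card_arc_line:
  assumes "is_line L" shows "card {v \<in> arc. v \<in> L} + card U \<le> q\<^sup>2"
  using assms
proof (cases rule: line_cases)
  case (z a b)
  \<comment> \<open>Modulo \<open>N\<close> the line misses \<open>(0:0:1)\<close>. In the same way
    \<open>no2\<close> below excludes the classes \<open>(0:1:c)\<close> and \<open>no1\<close> the
    affine points.\<close>
  have no3: "1 \<noteq> a * n + b * m" if "n \<in> N" "m \<in> N" for n m
    using N_add[OF N_mult_left N_mult_left, OF that] one_notin_N by metis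
  have "{v \<in> arc. v \<in> L} \<subseteq> (\<lambda>x. (1, x, a + b * x)) ` {x. \<not> bad1 x (a + b * x)}
      \<union> (\<lambda>n. (n, 1, a * n + b)) ` {n \<in> N. \<not> bad2 n (a * n + b)}"
  proof
    fix v assume v: "v \<in> {v \<in> arc. v \<in> L}"
    then consider x y where "v = (1, x, y)" "\<not> bad1 x y" | n y where "v = (n, 1, y)" "n \<in> N" "\<not> bad2 n y"
      | n m where "v = (n, m, 1)" "n \<in> N" "m \<in> N" by (auto simp: arc_def)
    then show "v \<in> (\<lambda>x. (1, x, a + b * x)) ` {x. \<not> bad1 x (a + b * x)}
      \<union> (\<lambda>n. (n, 1, a * n + b)) ` {n \<in> N. \<not> bad2 n (a * n + b)}"
    proof cases
      case 1
      then show ?thesis using z[of 1 x y] v by auto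
    next
      case 2
      then show ?thesis using z[of n 1 y] v by auto
    next
      case 3
      then show ?thesis using z[of n m 1] v no3 by auto
    qed
  qed
  then show ?thesis by (rule card_line_good) (rule bad_on_z_line)
next
  case (y a c)
  have no2: "1 \<noteq> a * n + c * y" if "n \<in> N" for n y
    using N_add[OF N_mult_left N_mult_right, OF that y(1)] one_notin_N by metis
  have "{v \<in> arc. v \<in> L} \<subseteq> (\<lambda>y. (1, a + c * y, y)) ` {y. \<not> bad1 (a + c * y) y}
      \<union> (\<lambda>n. (n, a * n + c, 1)) ` {n \<in> N. \<not> bad3 n}"
  proof
    fix v assume v: "v \<in> {v \<in> arc. v \<in> L}"
    then consider x y where "v = (1, x, y)" "\<not> bad1 x y" | n y where "v = (n, 1, y)" "n \<in> N"
      | n m where "v = (n, m, 1)" "n \<in> N" "\<not> bad3 n" by (auto simp: arc_def)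
    then show "v \<in> (\<lambda>y. (1, a + c * y, y)) ` {y. \<not> bad1 (a + c * y) y}
      \<union> (\<lambda>n. (n, a * n + c, 1)) ` {n \<in> N. \<not> bad3 n}"
    proof cases
      case (1 x' y')
      then show ?thesis using y(2)[of 1 x' y'] v by auto
    next
      case (2 n y')
      then show ?thesis using y(2)[of n 1 y'] v no2 by auto
    next
      case (3 n m)
      then show ?thesis using y(2)[of n m 1] v by auto
    qed
  qed
  then show ?thesis by (rule card_line_good) (rule bad_on_y_line[OF y(1)])
next
  case (x b c)
  have no1: "1 \<noteq> b * x' + c * y'" for x' y'
    using N_add[OF N_mult_right N_mult_right, OF x(1,2)] one_notin_N by metis
  have "{v \<in> arc. v \<in> L} \<subseteq> (\<lambda>y. (b + c * y, 1, y)) ` {y. \<not> bad2 (b + c * y) y}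
      \<union> (\<lambda>m. (c, m, 1)) ` {m \<in> N. \<not> bad3 c}"
  proof
    fix v assume v: "v \<in> {v \<in> arc. v \<in> L}"
    then consider x' y where "v = (1, x', y)" | n y where "v = (n, 1, y)" "\<not> bad2 n y"
      | n m where "v = (n, m, 1)" "m \<in> N" "\<not> bad3 n" by (auto simp: arc_def)
    then show "v \<in> (\<lambda>y. (b + c * y, 1, y)) ` {y. \<not> bad2 (b + c * y) y}
      \<union> (\<lambda>m. (c, m, 1)) ` {m \<in> N. \<not> bad3 c}"
    proof cases
      case (1 x' y)
      then show ?thesis using x(3)[of 1 x' y] v no1 by auto
    next
      case (2 n y)
      then show ?thesis using x(3)[of n 1 y] v by auto
    next
      case (3 n m)
      then show ?thesis using x(3)[of n m 1] v N_sq[OF x(1)] by auto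
    qed
  qed
  then show ?thesis by (rule card_line_good) (rule bad_on_x_line[OF x(1,2)])
qed

section \<open>Counting all bad points\<close>

lemma card_all_bad1: "card {(x, y). bad1 x y} \<le> (q + card heavy) * q\<^sup>2"
proof -
  \<comment> \<open>\<open>?A\<close> and \<open>?B\<close> hold the two segments of each heavy
    class, \<open>?C\<close> the segments of the other affine classes. Overlaps are harmless for an
    upper bound; the identity in \<open>?A\<close> lets \<open>card_image_le\<close> treat all three
    alike.\<close>
  let ?A = "(\<lambda>p. p) ` (heavy \<times> (UNIV :: 'a set))"
  let ?B = "(\<lambda>(t, y). (t + \<phi> (rep y), y)) ` (heavy \<times> UNIV)"
  let ?C = "(\<lambda>(t, n, d). (t + n, d + t * (t + n))) ` ((T - heavy) \<times> N \<times> T)"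
  have "{(x, y). bad1 x y} \<subseteq> ?A \<union> ?B \<union> ?C"
  proof clarify
    fix x y assume bad: "bad1 x y" and C: "(x, y) \<notin> ?C" and B: "(x, y) \<notin> ?B"
    show "(x, y) \<in> ?A"
    proof (cases "rep x \<in> heavy")
      case True
      have "x - rep x \<noteq> \<phi> (rep y)"
      proof
        assume "x - rep x = \<phi> (rep y)"
        then have "(x, y) = (\<lambda>(t, y). (t + \<phi> (rep y), y)) (rep x, y)" by (auto simp: algebra_simps)
        then show False using B True by blast
      qed
      then have "x = rep x" using bad True by (simp add: bad1_def)
      then show ?thesis using True by auto
    next
      case False
      have "(x, y) = (\<lambda>(t, n, d). (t + n, d + t * (t + n))) (rep x, x - rep x, y - rep x * x)" by simp
      moreover have "(rep x, x - rep x, y - rep x * x) \<in> (T - heavy) \<times> N \<times> T"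
        using bad False rep_T rep_diff by (auto simp: bad1_def)
      ultimately show ?thesis using C by blast
    qed
  qed
  then have "card {(x, y). bad1 x y} \<le> card (?A \<union> ?B \<union> ?C)" by (intro card_mono) auto
  also have "\<dots> \<le> card ?A + card ?B + card ?C"
    using card_Un_le[of "?A \<union> ?B" ?C] card_Un_le[of ?A ?B] by linarith
  also have "\<dots> \<le> card (heavy \<times> (UNIV :: 'a set)) + card (heavy \<times> (UNIV :: 'a set)) + card ((T - heavy) \<times> N \<times> T)"
    by (intro add_mono card_image_le) auto
  also have "\<dots> = card heavy * q\<^sup>2 + card heavy * q\<^sup>2 + (q - card heavy) * q\<^sup>2"
    using heavy_T by (simp add: card_cartesian_product card_R card_T card_N card_Diff_subset power2_eq_square)
  also have "\<dots> = (card heavy + card heavy + (q - card heavy)) * q\<^sup>2" by (simp add: distrib_right)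
  also have "card heavy + card heavy + (q - card heavy) = q + card heavy" using card_U card_U_le by simp
  finally show ?thesis .
qed

lemma card_all_bad2: "card {(n, y). n \<in> N \<and> bad2 n y} \<le> (3 * q - card heavy) * q"
proof -
  let ?S = "SIGMA c:T. D c \<times> N"
  have "{(n, y). n \<in> N \<and> bad2 n y} \<subseteq> (\<lambda>(c, n, m). (n, c + m)) ` ?S"
  proof clarify
    fix n y assume "bad2 n y"
    then show "(n, y) \<in> (\<lambda>(c, n, m). (n, c + m)) ` ?S"
      using rep_T[of y] rep_diff[of y]
      by (intro image_eqI[of _ _ "(rep y, n, y - rep y)"]) (auto simp: bad2_def)
  qed
  then have "card {(n, y). n \<in> N \<and> bad2 n y} \<le> card ((\<lambda>(c, n, m). (n, c + m)) ` ?S)"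
    by (intro card_mono) auto
  also have "\<dots> \<le> card ?S" by (rule card_image_le) auto
  also have "\<dots> = (\<Sum>c\<in>T. card (D c)) * q"
    by (simp add: card_cartesian_product card_N sum_distrib_right)
  also have "(\<Sum>c\<in>T. card (D c)) = (\<Sum>c\<in>T. if c \<in> heavy then 2 else 3)"
    by (rule sum.cong) (simp_all add: card_D)
  also have "\<dots> = 3 * q - card heavy"
    using card_U card_U_le by (simp add: sum_T_heavy)
  finally show ?thesis .
qed

text \<open>With \<open>s = card U\<close> the counts add up to at most
  \<open>q^3 + (s + 1) q^2 + 2 q\<close> bad points among \<open>q^4 + q^3 + q^2\<close>.\<close>

lemma card_arc: "q ^ 4 \<le> card arc + card U * q\<^sup>2 + 2 * q"
proof -
  let ?G1 = "{(x, y). \<not> bad1 x y}" and ?G2 = "{(n, y). n \<in> N \<and> \<not> bad2 n y}"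
    and ?G3 = "{n \<in> N. \<not> bad3 n} \<times> N"
  let ?A1 = "(\<lambda>(x, y). (1 :: 'a, x, y)) ` ?G1" and ?A2 = "(\<lambda>(n, y). (n, 1 :: 'a, y)) ` ?G2"
    and ?A3 = "(\<lambda>(n, m). (n, m, 1 :: 'a)) ` ?G3"
  have "arc = (?A1 \<union> ?A2) \<union> ?A3" by (auto simp: arc_def)
  moreover have "(?A1 \<union> ?A2) \<inter> ?A3 = {}" "?A1 \<inter> ?A2 = {}" using one_notin_N by auto
  ultimately have "card arc = card ?A1 + card ?A2 + card ?A3" by (simp add: card_Un_disjoint)
  also have "card ?A1 = card ?G1" by (intro card_image) (auto simp: inj_on_def)
  also have "card ?A2 = card ?G2" by (intro card_image) (auto simp: inj_on_def)
  also have "card ?A3 = card ?G3" by (intro card_image) (auto simp: inj_on_def)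
  finally have arc: "card arc = card ?G1 + card ?G2 + card ?G3" .
  have "card (?G1 \<union> {(x, y). bad1 x y}) \<le> card ?G1 + card {(x, y). bad1 x y}" by (rule card_Un_le)
  moreover have "?G1 \<union> {(x, y). bad1 x y} = UNIV \<times> UNIV" by auto
  ultimately have 1: "q ^ 4 \<le> card ?G1 + (q + card heavy) * q\<^sup>2"
    using card_all_bad1 card_cartesian_product[of "UNIV :: 'a set" "UNIV :: 'a set"] card_R
    by (simp flip: power_add)
  have "card (?G2 \<union> {(n, y). n \<in> N \<and> bad2 n y}) \<le> card ?G2 + card {(n, y). n \<in> N \<and> bad2 n y}"
    by (rule card_Un_le)
  moreover have "?G2 \<union> {(n, y). n \<in> N \<and> bad2 n y} = N \<times> UNIV" by auto
  ultimately have 2: "q * q\<^sup>2 \<le> card ?G2 + (3 * q - card heavy) * q"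
    using card_all_bad2 card_R card_N by (simp add: card_cartesian_product)
  have "{n \<in> N. \<not> bad3 n} = N - {n \<in> N. bad3 n}" by auto
  then have "card {n \<in> N. \<not> bad3 n} = q - card U"
    using card_bad3 card_N by (simp add: card_Diff_subset)
  then have 3: "card ?G3 = (q - card U) * q" by (simp add: card_cartesian_product card_N)
  \<comment> \<open>This substitution resolves the truncated differences \<open>q - card U\<close>
    and \<open>3 * q - card heavy\<close>.\<close>
  obtain k where k: "q = card heavy + 2 + k" using card_U card_U_le le_Suc_ex by metis
  show ?thesis
    using 1 2 unfolding arc 3 card_U
    by (simp add: k power2_eq_square algebra_simps)
qed

lemma arc_exists:
  assumes "n + card U = q\<^sup>2"
  shows "\<exists>P :: 'a vec3 set set. proj_arc (q\<^sup>2 * n - 2 * q) n P"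
proof (rule proj_arc_of_vectors[OF arc_normalised])
  have "q\<^sup>2 * n + card U * q\<^sup>2 = q\<^sup>2 * (n + card U)" by (simp add: algebra_simps)
  also have "\<dots> = q ^ 4" unfolding assms by (simp flip: power_add)
  finally have "q\<^sup>2 * n + card U * q\<^sup>2 = q ^ 4" .
  then show "q\<^sup>2 * n - 2 * q \<le> card arc" using card_arc by linarith
  show "card {v \<in> arc. v \<in> L} \<le> n" if "is_line L" for L
    using card_arc_line[OF that] assms by linarith
qed

end

section \<open>Choice of the parameters and the bound for \<open>m_n\<close>\<close>

lemma (in len2_chain_ring) ex_proj_arc:
  assumes "q\<^sup>2 - q \<le> n" "n \<le> q\<^sup>2 - 2"
  shows "\<exists>P :: 'a vec3 set set. proj_arc (q\<^sup>2 * n - 2 * q) n P"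
proof -
  have "card {0, 1 :: 'a} \<le> q" using card_mono[of T "{0, 1}"] zero_T one_T card_T by simp
  then have "2 \<le> q" by simp
  then consider "q = 2" | "3 \<le> q" by linarith
  then show ?thesis
  proof cases
    case 1
    then have "n = 2" using assms by simp
    then show ?thesis using frame_arc 1 by simp
  next
    case 2
    have "q * 1 \<le> q\<^sup>2" unfolding power2_eq_square using 2 by (intro mult_left_mono) auto
    define s where "s = q\<^sup>2 - n"
    have s: "2 \<le> s" "s \<le> q" "n + s = q\<^sup>2" using assms \<open>q * 1 \<le> q\<^sup>2\<close> 2 by (auto simp: s_def)
    have "card (T - {0, 1}) = q - 2" using zero_T one_T card_T by (simp add: card_Diff_subset)
    \<comment> \<open>\<open>W\<close> becomes the set \<open>heavy\<close>, so that
      \<open>U\<close> gets \<open>s\<close> elements.\<close>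
    then obtain W where W: "W \<subseteq> T - {0, 1}" "card W = s - 2"
      using s by (metis diff_le_mono obtain_subset_with_card_n)
    have "card (N - {0, \<theta>}) = q - 2" using theta_N theta_nz card_N by (simp add: card_Diff_subset)
    then have "N - {0, \<theta>} \<noteq> {}" using 2 by (metis card.empty diff_is_0_eq not_less_eq_eq numeral_2_eq_2 numeral_3_eq_3)
    then obtain e where e: "e \<in> N" "e \<noteq> 0" "e \<noteq> \<theta>" by blast
    interpret arc_construction N T q \<theta> "insert 0 (insert 1 W)" e
      using W e zero_T one_T by unfold_locales auto
    have "card (insert 0 (insert 1 W)) = s"
      using W s by (subst card_insert_disjoint; auto simp: card_insert_if)
    then show ?thesis using arc_exists s by simp
  qed
qed

text \<open>One representative is chosen per coset, with 0 and 1 prescribed for theirs. Congruent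
  elements give \<open>SOME\<close> the same predicate, so the choice is constant on cosets.\<close>

lemma ex_transversal:
  fixes N :: "'a::{ring_1,finite} set"
  assumes "right_ideal N" "1 \<notin> N"
  shows "\<exists>T. 0 \<in> T \<and> 1 \<in> T \<and> (\<forall>r. \<exists>!t. t \<in> T \<and> r - t \<in> N)"
proof -
  have add: "x + y \<in> N" if "x \<in> N" "y \<in> N" for x y using assms that by (auto simp: right_ideal_def)
  have neg: "- x \<in> N" if "x \<in> N" for x using assms that by (auto simp: right_ideal_def)
  have sym: "x - y \<in> N \<longleftrightarrow> y - x \<in> N" for x y using neg[of "x - y"] neg[of "y - x"] by auto
  have trans: "x - z \<in> N" if "x - y \<in> N" "y - z \<in> N" for x y z using add[OF that] by simp
  define f where "f r = (if r \<in> N then 0 else if r - 1 \<in> N then 1 else SOME t. r - t \<in> N)" for r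
  have f: "r - f r \<in> N" for r
    using assms(1) someI[of "\<lambda>t. r - t \<in> N" r] by (auto simp: f_def right_ideal_def)
  have f_cong: "f x = f y" if "x - y \<in> N" for x y
  proof -
    have eq: "x - z \<in> N \<longleftrightarrow> y - z \<in> N" for z using trans sym that by blast
    show ?thesis using eq[of 0] by (simp add: f_def eq)
  qed
  have f01: "f 0 = 0" "f 1 = 1" using assms by (auto simp: f_def right_ideal_def)
  have "\<exists>!t. t \<in> range f \<and> r - t \<in> N" for r
  proof (rule ex1I[of _ "f r"])
    fix t assume t: "t \<in> range f \<and> r - t \<in> N"
    then obtain x where x: "t = f x" by blast
    have "t - r \<in> N" using t sym[of t r] by simp
    then have "x - r \<in> N" using trans[of x t r] f[of x] x by simp
    then show "t = f r" using f_cong[of x r] x by simp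
  qed (use f in auto)
  moreover have "0 \<in> range f" "1 \<in> range f" using f01 by (metis rangeI)+
  ultimately show ?thesis by blast
qed

lemma proj_arc_le_m_n:
  assumes "proj_arc k n (P :: 'a::{ring_1,finite} vec3 set set)"
  shows "k \<le> m_n TYPE('a) n"
proof -
  have "{k. \<exists>P :: 'a vec3 set set. proj_arc k n P} \<subseteq> range (card :: 'a vec3 set set \<Rightarrow> nat)"
    by (auto simp: proj_arc_def)
  then have "finite {k. \<exists>P :: 'a vec3 set set. proj_arc k n P}" by (rule finite_subset) simp
  then show ?thesis unfolding m_n_def using assms by (intro Max_ge) auto
qed

theorem theorem3p2:
  fixes q n :: nat
  assumes "chain_ring_len2 TYPE('a::{ring_1,finite})"
    and "residue_card TYPE('a) = q"
    and "q^2 - q \<le> n" and "n \<le> q^2 - 2"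
  shows "(\<exists>P :: 'a vec3 set set. proj_arc (q^2 * n - 2 * q) n P)
    \<and> (\<forall>t. n = q^2 - q + t \<longrightarrow>
         int (m_n TYPE('a) n) \<ge> int q * (int q + 1) * int n - int q ^ 3 + int q * (int q - 2 - int t))"
proof -
  define N :: "'a set" where "N = rad TYPE('a)"
  have chain: "N \<noteq> {0}" "\<And>x y. x \<in> N \<Longrightarrow> y \<in> N \<Longrightarrow> x * y = 0"
    "{I. right_ideal I} = {UNIV, N, {0}}" "{I. left_ideal I} = {UNIV, N, {0}}"
    using assms(1) unfolding chain_ring_len2_def N_def by blast+
  have N: "right_ideal N" "left_ideal N" using chain(3,4) by blast+
  have one: "1 \<notin> N" using chain(2)[of 1 1] by auto
  obtain T where T: "0 \<in> T" "1 \<in> T" "\<forall>r. \<exists>!t. t \<in> T \<and> r - t \<in> N"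
    using ex_transversal[OF N(1) one] by blast
  have "0 \<in> N" using N by (simp add: right_ideal_def)
  then obtain \<theta> where \<theta>: "\<theta> \<in> N" "\<theta> \<noteq> 0" using chain(1) by blast
  interpret len2_chain_ring N T q \<theta>
  proof
    show "I \<in> {UNIV, N, {0}}" if "right_ideal I" for I using chain(3) that by blast
    show "card (UNIV :: 'a set) div card N = q" using assms(2) by (simp add: residue_card_def N_def)
  qed (use N chain(2) one T \<theta> in blast)+
  obtain P :: "'a vec3 set set" where P: "proj_arc (q\<^sup>2 * n - 2 * q) n P"
    using ex_proj_arc assms(3,4) by blast
  have "int q * (int q + 1) * int n - int q ^ 3 + int q * (int q - 2 - int t) \<le> int (m_n TYPE('a) n)"
    if t: "n = q\<^sup>2 - q + t" for t
  proof -
    have "q \<le> q\<^sup>2" by (simp add: power2_nat_le_imp_le self_le_power)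
    then have n: "int n = int q ^ 2 - int q + int t" by (simp add: t of_nat_diff)
    have "int q * (int q + 1) * int n - int q ^ 3 + int q * (int q - 2 - int t)
        = int q ^ 2 * int n - 2 * int q"
      unfolding n by (simp add: algebra_simps power2_eq_square power3_eq_cube)
    also have "\<dots> = int (q\<^sup>2 * n) - int (2 * q)" by simp
    \<comment> \<open>Truncated subtraction can only enlarge the value.\<close>
    also have "\<dots> \<le> int (q\<^sup>2 * n - 2 * q)" by linarith
    also have "\<dots> \<le> int (m_n TYPE('a) n)" using proj_arc_le_m_n[OF P] by simp
    finally show ?thesis .
  qed
  then show ?thesis using P by blast
qed

end
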